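(* Let $K$ be a finite field, let $S=K[t_1,\ldots,t_s]$, let $X=\{P_1,\ldots,P_m\}\subset K^s$ be a set of $m\geq 2$ points, and let $I=I(X)$ be its vanishing ideal. Then $\mathrm{v}(I)=\mathrm{reg}(\delta_X)\leq\mathrm{reg}(H_I^a)$.
   Context: $I(X)$ is the ideal of all polynomials vanishing on $X$. For $d\ge 0$, $S_{\le d}$ is the space of polynomials of total degree at most $d$ and $I_{\le d}=I\cap S_{\le d}$. The affine Hilbert function is $H_I^a(d)=\dim_K(S_{\le d}/I_{\le d})$, and $\mathrm{reg}(H_I^a)$ is the least integer $\ell\ge 0$ with $H_I^a(d)=|X|$ for all $d\ge\ell$. $C_X(d)=\{(f(P_1),\ldots,f(P_m)): f\in S_{\le d}\}\subset K^m$ is the Reed--Muller-type code of degree $d$, and $\delta_X(d)$ is its minimum distance (the minimum Hamming weight of a nonzero codeword). It is known that there is $n\in\mathbb{N}$ such that $|X|=\delta_X(0)>\delta_X(1)>\cdots>\delta_X(n-1)>\delta_X(n)=\delta_X(d)=1$ for all $d\ge n$; this number $n$ is denoted $\mathrm{reg}(\delta_X)$ and called the regularity index of $\delta_X$. The v-number of $I$ is $\mathrm{v}(I)=\min\{d\ge 0:$ there are $0\ne f\in S$ with $\deg(f)=d$ and $\mathfrak{p}\in\mathrm{Ass}(I)$ with $(I\colon f)=\mathfrak{p}\}$, where $\mathrm{Ass}(I)$ is the set of associated primes of $S/I$ and $(I\colon f)=\{g\in S: gf\in I\}$. *)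

theory Defs
  imports
    "HOL-Library.Poly_Mapping"
    "HOL-Algebra.QuotRing"
    "Jordan_Normal_Form.VS_Connect"
begin

text \<open>
  The polynomial ring \<open>K[t\<^sub>1,\<dots>,t\<^sub>s]\<close> is the type \<open>('s \<Rightarrow>\<^sub>0 nat) \<Rightarrow>\<^sub>0 'k\<close>, with the variables
  indexed by a finite type \<open>'s\<close>; affine space \<open>K\<^sup>s\<close> is \<open>'s \<Rightarrow> 'k\<close>.  The record \<^term>\<open>class_ring\<close> is
  the ring on a whole type, so that ideals and primes are those of HOL-Algebra.
\<close>

type_synonym ('s, 'k) mpoly = "('s \<Rightarrow>\<^sub>0 nat) \<Rightarrow>\<^sub>0 'k"

definition mpoly_eval :: "('s::finite, 'k::comm_ring_1) mpoly \<Rightarrow> ('s \<Rightarrow> 'k) \<Rightarrow> 'k" where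
  "mpoly_eval f x =
     (\<Sum>a\<in>Poly_Mapping.keys f. Poly_Mapping.lookup f a * (\<Prod>i\<in>UNIV. x i ^ Poly_Mapping.lookup a i))"

text \<open>The zero polynomial gets total degree 0, hence lies in every \<open>S\<^bsub>\<le>d\<^esub>\<close>.\<close>

definition total_degree :: "('s::finite, 'k::zero) mpoly \<Rightarrow> nat" where
  "total_degree f = Max (insert 0 ((\<lambda>a. \<Sum>i\<in>UNIV. Poly_Mapping.lookup a i) ` Poly_Mapping.keys f))"

definition polys_le :: "nat \<Rightarrow> ('s::finite, 'k::zero) mpoly set" where
  "polys_le d = {f. total_degree f \<le> d}"

definition vanishing_ideal :: "('s::finite \<Rightarrow> 'k::comm_ring_1) set \<Rightarrow> ('s, 'k) mpoly set" where
  "vanishing_ideal X = {f. \<forall>x\<in>X. mpoly_eval f x = 0}"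

text \<open>
  The quotient vector space \<open>V/W\<close> of subspaces \<open>W \<subseteq> V\<close> of the polynomial ring, with the cosets
  \<open>v + W\<close> as vectors.  The fields \<open>mult\<close> and \<open>one\<close> of the record play no role for modules.
\<close>

definition quotient_space ::
  "('s, 'k::comm_ring_1) mpoly set \<Rightarrow> ('s, 'k) mpoly set \<Rightarrow> ('k, ('s, 'k) mpoly set) module" where
  "quotient_space V W =
     \<lparr>carrier = {(+) v ` W | v. v \<in> V}, mult = undefined, one = undefined,
      zero = W, add = (\<lambda>A B. {a + b | a b. a \<in> A \<and> b \<in> B}),
      smult = (\<lambda>c A. \<Union>a\<in>A. (+) (Poly_Mapping.single 0 c * a) ` W)\<rparr>"

definition affine_hilbert :: "('s::finite, 'k::field) mpoly set \<Rightarrow> nat \<Rightarrow> nat" where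
  "affine_hilbert I d =
     vectorspace.dim (class_ring :: 'k ring) (quotient_space (polys_le d) (I \<inter> polys_le d))"

definition reg_hilbert :: "('s::finite \<Rightarrow> 'k::field) set \<Rightarrow> nat" where
  "reg_hilbert X = (LEAST l. \<forall>d\<ge>l. affine_hilbert (vanishing_ideal X) d = card X)"

text \<open>
  The points \<open>P\<^sub>1,\<dots>,P\<^sub>m\<close> are a family indexed by a finite type \<open>'m\<close>, and \<open>K\<^sup>m\<close> is \<open>'m \<Rightarrow> 'k\<close>.
\<close>

definition rm_code :: "('m::finite \<Rightarrow> 's::finite \<Rightarrow> 'k::comm_ring_1) \<Rightarrow> nat \<Rightarrow> ('m \<Rightarrow> 'k) set" where
  "rm_code P d = {\<lambda>j. mpoly_eval f (P j) | f. f \<in> polys_le d}"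

definition hamming_weight :: "('m::finite \<Rightarrow> 'k::zero) \<Rightarrow> nat" where
  "hamming_weight c = card {j. c j \<noteq> 0}"

definition min_distance :: "('m::finite \<Rightarrow> 'k::zero) set \<Rightarrow> nat" where
  "min_distance C = (LEAST w. \<exists>c\<in>C. c \<noteq> (\<lambda>_. 0) \<and> hamming_weight c = w)"

definition rm_distance :: "('m::finite \<Rightarrow> 's::finite \<Rightarrow> 'k::comm_ring_1) \<Rightarrow> nat \<Rightarrow> nat" where
  "rm_distance P d = min_distance (rm_code P d)"

definition reg_distance :: "('m::finite \<Rightarrow> 's::finite \<Rightarrow> 'k::comm_ring_1) \<Rightarrow> nat" where
  "reg_distance P = (THE n.
     card (range P) = rm_distance P 0 \<and>
     (\<forall>i<n. rm_distance P i > rm_distance P (Suc i)) \<and>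
     (\<forall>d\<ge>n. rm_distance P d = 1))"

text \<open>
  \<open>Ass(I)\<close> is the set of associated primes of the \<open>R\<close>-module \<open>R/I\<close>: the primes that are the
  annihilator of an element \<open>x\<close> of \<open>R/I\<close>, where \<open>r\<in>R\<close> acts as multiplication by its class.
\<close>

definition assoc_primes :: "('a, 'b) ring_scheme \<Rightarrow> 'a set \<Rightarrow> 'a set set" where
  "assoc_primes R I = {p. primeideal p R \<and>
     (\<exists>x\<in>carrier (R Quot I).
        p = {r \<in> carrier R. (I +>\<^bsub>R\<^esub> r) \<otimes>\<^bsub>R Quot I\<^esub> x = \<zero>\<^bsub>R Quot I\<^esub>})}"

definition colon_ideal :: "'a::times set \<Rightarrow> 'a \<Rightarrow> 'a set" where
  "colon_ideal I f = {g. g * f \<in> I}"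

definition v_number :: "('s::finite, 'k::field) mpoly set \<Rightarrow> nat" where
  "v_number I = (LEAST d. \<exists>f p. f \<noteq> 0 \<and> total_degree f = d \<and>
     p \<in> assoc_primes class_ring I \<and> colon_ideal I f = p)"

end

theory Submission
  imports Defs
begin

text \<open>
  Everything is read off from the supports of codewords.  For a polynomial \<open>f\<close>, the colon ideal
  \<open>(I : f)\<close> consists of the polynomials that vanish at those points of \<open>X\<close> at which \<open>f\<close> does not:
  it is the vanishing ideal of the support of the codeword of \<open>f\<close>
  (\<open>colon_vanishing_ideal\<close>).  The vanishing ideal of a subset of \<open>X\<close> is prime exactly when the subset
  is a single point, since with a second point present an interpolation polynomial \<open>e\<close> of the first
  one gives zero divisors \<open>e\<close> and \<open>1 - e\<close> modulo this ideal (\<open>primeideal_vanishing_ideal_iff\<close>).  So \<open>(I : f)\<close> is an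
  associated prime iff the codeword of \<open>f\<close> has weight 1, and \<open>v(I)\<close> is the least degree in which a
  codeword of weight 1 occurs, that is, the least \<open>d\<close> with \<open>\<delta>\<^sub>X(d) = 1\<close>.

  On the other side, as long as \<open>\<delta>\<^sub>X(d) > 1\<close> the distance drops at the next degree: a minimum weight
  codeword has two points \<open>P\<^sub>a\<close>, \<open>P\<^sub>b\<close> in its support, they differ in some coordinate \<open>i\<close>, and
  multiplication by \<open>t\<^sub>i - P\<^sub>a(i)\<close> removes the first point from the support and keeps the second
  (\<open>rm_distance_decreasing\<close>).  Hence the least \<open>d\<close> with \<open>\<delta>\<^sub>X(d) = 1\<close> is also the regularity index
  of \<open>\<delta>\<^sub>X\<close> (\<open>reg_distance_eq_Least\<close>).

  For the inequality, \<open>S\<^bsub>\<le>d\<^esub>/I\<^bsub>\<le>d\<^esub>\<close> is in bijection with the code \<open>C\<^sub>X(d)\<close>.  A space of dimension \<open>h\<close>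
  over a field with \<open>q\<close> elements has \<open>q\<^sup>h\<close> elements, so the Hilbert function takes the value \<open>|X|\<close> at
  \<open>d\<close> iff \<open>C\<^sub>X(d)\<close> is the whole space \<open>K\<^sup>m\<close> (\<open>affine_hilbert_eq_card_iff\<close>); and the whole space
  contains words of weight 1.
\<close>


section \<open>Evaluation of polynomials\<close>

definition monom_eval :: "('s::finite \<Rightarrow>\<^sub>0 nat) \<Rightarrow> ('s \<Rightarrow> 'k::comm_ring_1) \<Rightarrow> 'k" where
  "monom_eval a x = (\<Prod>i\<in>UNIV. x i ^ Poly_Mapping.lookup a i)"

lemma monom_eval_zero [simp]: "monom_eval 0 x = 1"
  by (simp add: monom_eval_def)

lemma monom_eval_add: "monom_eval (a + b) x = monom_eval a x * monom_eval b x"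
  by (simp add: monom_eval_def lookup_add power_add prod.distrib)

lemma monom_eval_variable: "monom_eval (Poly_Mapping.single i 1) x = x i"
proof -
  have "monom_eval (Poly_Mapping.single i 1) x = (\<Prod>j\<in>UNIV. if j = i then x j else 1)"
    unfolding monom_eval_def by (rule prod.cong) (auto simp: lookup_single when_def)
  then show ?thesis by simp
qed

lemma mpoly_eval_alt:
  "mpoly_eval f x = (\<Sum>a\<in>Poly_Mapping.keys f. Poly_Mapping.lookup f a * monom_eval a x)"
  by (simp add: mpoly_eval_def monom_eval_def)

lemma mpoly_eval_zero [simp]: "mpoly_eval 0 x = 0"
  by (simp add: mpoly_eval_def)

lemma mpoly_eval_single: "mpoly_eval (Poly_Mapping.single a c) x = c * monom_eval a x"
  by (simp add: mpoly_eval_alt)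

lemma mpoly_eval_const [simp]: "mpoly_eval (Poly_Mapping.single 0 c) x = c"
  by (simp add: mpoly_eval_single)

lemma mpoly_eval_one [simp]: "mpoly_eval 1 x = 1"
  using mpoly_eval_const [of 1 x] by simp

lemma mpoly_eval_add [simp]: "mpoly_eval (f + g) x = mpoly_eval f x + mpoly_eval g x"
  unfolding mpoly_eval_alt
  by (rule setsum_keys_plus_distrib) (auto simp: algebra_simps)

lemma mpoly_eval_sum: "mpoly_eval (\<Sum>i\<in>A. f i) x = (\<Sum>i\<in>A. mpoly_eval (f i) x)"
  by (induction A rule: infinite_finite_induct) auto

lemma poly_mapping_eq_sum_single:
  "f = (\<Sum>a\<in>Poly_Mapping.keys f. Poly_Mapping.single a (Poly_Mapping.lookup f a))"
  by (rule poly_mapping_eqI)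
    (auto simp: lookup_sum lookup_single when_def in_keys_iff)

lemma mpoly_eval_mult [simp]: "mpoly_eval (f * g) x = mpoly_eval f x * mpoly_eval g x"
proof -
  let ?s = "\<lambda>f a. Poly_Mapping.single a (Poly_Mapping.lookup f a)"
  have "f * g = (\<Sum>a\<in>Poly_Mapping.keys f. ?s f a) * (\<Sum>b\<in>Poly_Mapping.keys g. ?s g b)"
    by (simp flip: poly_mapping_eq_sum_single)
  also have "\<dots> = (\<Sum>a\<in>Poly_Mapping.keys f. \<Sum>b\<in>Poly_Mapping.keys g.
      Poly_Mapping.single (a + b) (Poly_Mapping.lookup f a * Poly_Mapping.lookup g b))"
    by (simp add: sum_product mult_single)
  finally have "mpoly_eval (f * g) x = (\<Sum>a\<in>Poly_Mapping.keys f. \<Sum>b\<in>Poly_Mapping.keys g.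
      Poly_Mapping.lookup f a * Poly_Mapping.lookup g b * (monom_eval a x * monom_eval b x))"
    by (simp add: mpoly_eval_sum mpoly_eval_single monom_eval_add)
  also have "\<dots> = mpoly_eval f x * mpoly_eval g x"
    by (simp add: mpoly_eval_alt sum_product algebra_simps)
  finally show ?thesis .
qed

lemma mpoly_eval_uminus [simp]: "mpoly_eval (- f) x = - mpoly_eval f x"
  using mpoly_eval_add [of "- f" f x] by (simp add: eq_neg_iff_add_eq_0)

lemma mpoly_eval_diff [simp]: "mpoly_eval (f - g) x = mpoly_eval f x - mpoly_eval g x"
  using mpoly_eval_add [of f "- g" x] by simp

definition linear_poly :: "'s::finite \<Rightarrow> 'k::comm_ring_1 \<Rightarrow> ('s, 'k) mpoly" where
  "linear_poly i c = Poly_Mapping.single (Poly_Mapping.single i 1) 1 - Poly_Mapping.single 0 c"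

lemma mpoly_eval_linear_poly [simp]: "mpoly_eval (linear_poly i c) x = x i - c"
  using monom_eval_variable [of i x] by (simp add: linear_poly_def mpoly_eval_single)


section \<open>Polynomials of bounded total degree\<close>

lemma polys_le_iff:
  "f \<in> polys_le d \<longleftrightarrow> (\<forall>a\<in>Poly_Mapping.keys f. (\<Sum>i\<in>UNIV. Poly_Mapping.lookup a i) \<le> d)"
  by (auto simp: polys_le_def total_degree_def)

lemma polys_le_mono: "d \<le> e \<Longrightarrow> polys_le d \<subseteq> polys_le e"
  by (auto simp: polys_le_def)

lemma const_in_polys_le: "Poly_Mapping.single 0 c \<in> polys_le d"
  by (simp add: polys_le_iff)

lemma zero_in_polys_le: "0 \<in> polys_le d"
  by (simp add: polys_le_iff)

lemma add_in_polys_le: "f \<in> polys_le d \<Longrightarrow> g \<in> polys_le d \<Longrightarrow> f + g \<in> polys_le d"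
  unfolding polys_le_iff using Poly_Mapping.keys_add [of f g] by blast

lemma mult_in_polys_le:
  assumes "f \<in> polys_le d" and "g \<in> polys_le e"
  shows "f * g \<in> polys_le (d + e)"
  unfolding polys_le_iff
proof
  fix c assume "c \<in> Poly_Mapping.keys (f * g)"
  then obtain a b where "c = a + b" "a \<in> Poly_Mapping.keys f" "b \<in> Poly_Mapping.keys g"
    using keys_mult [of f g] by blast
  then show "(\<Sum>i\<in>UNIV. Poly_Mapping.lookup c i) \<le> d + e"
    using assms by (auto simp: polys_le_iff lookup_add sum.distrib intro!: add_mono)
qed

lemma const_mult_in_polys_le: "f \<in> polys_le d \<Longrightarrow> Poly_Mapping.single 0 c * f \<in> polys_le d"
  using mult_in_polys_le [OF const_in_polys_le [of c 0]] by auto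

lemma linear_poly_in_polys_le:
  fixes c :: "'k::comm_ring_1"
  shows "linear_poly i c \<in> polys_le 1"
proof -
  have "Poly_Mapping.single (Poly_Mapping.single i 1) (1::'k) \<in> polys_le 1"
    by (auto simp: polys_le_iff lookup_single when_def)
  from add_in_polys_le [OF this const_in_polys_le [of "- c"]] show ?thesis
    by (simp add: linear_poly_def single_uminus)
qed

lemma polys_le_zero_const:
  assumes "f \<in> polys_le 0"
  shows "f = Poly_Mapping.single 0 (Poly_Mapping.lookup f 0)"
proof (rule poly_mapping_eqI)
  fix a
  show "Poly_Mapping.lookup f a
      = Poly_Mapping.lookup (Poly_Mapping.single 0 (Poly_Mapping.lookup f 0)) a"
  proof (cases "a = 0")
    case False
    then obtain i where "Poly_Mapping.lookup a i \<noteq> 0"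
      by (metis lookup_zero poly_mapping_eqI)
    then have "a \<notin> Poly_Mapping.keys f"
      using assms by (auto simp: polys_le_iff)
    with False show ?thesis by (simp add: in_keys_iff lookup_single)
  qed simp
qed


section \<open>Evaluation codes and their minimum distance\<close>

definition codeword :: "('m \<Rightarrow> 's::finite \<Rightarrow> 'k::comm_ring_1) \<Rightarrow> ('s, 'k) mpoly \<Rightarrow> 'm \<Rightarrow> 'k" where
  "codeword P f = (\<lambda>j. mpoly_eval f (P j))"

lemma rm_code_eq: "rm_code P d = codeword P ` polys_le d"
  by (auto simp: rm_code_def codeword_def)

lemma hamming_weight_pos: "c \<noteq> (\<lambda>_. 0) \<Longrightarrow> hamming_weight c \<ge> 1"
  by (auto simp: hamming_weight_def Suc_le_eq card_gt_0_iff)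

lemma hamming_weight_one_iff: "hamming_weight c = 1 \<longleftrightarrow> (\<exists>j. {j. c j \<noteq> 0} = {j})"
  by (simp add: hamming_weight_def card_1_singleton_iff)

lemma rm_distance_attained:
  fixes P :: "'m::finite \<Rightarrow> 's::finite \<Rightarrow> 'k::comm_ring_1"
  obtains f where "f \<in> polys_le d" "codeword P f \<noteq> (\<lambda>_. 0)"
    "hamming_weight (codeword P f) = rm_distance P d"
proof -
  have "Poly_Mapping.single 0 1 \<in> polys_le d" "codeword P (Poly_Mapping.single 0 1) \<noteq> (\<lambda>_. 0)"
    by (rule const_in_polys_le) (simp add: codeword_def fun_eq_iff)
  then have "\<exists>w. \<exists>c\<in>rm_code P d. c \<noteq> (\<lambda>_. 0) \<and> hamming_weight c = w"
    unfolding rm_code_eq by blast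
  from LeastI_ex [OF this] show ?thesis
    using that by (auto simp: rm_distance_def min_distance_def rm_code_eq)
qed

lemma rm_distance_le:
  assumes "f \<in> polys_le d" and "codeword P f \<noteq> (\<lambda>_. 0)"
  shows "rm_distance P d \<le> hamming_weight (codeword P f)"
  unfolding rm_distance_def min_distance_def
  by (rule Least_le) (use assms in \<open>auto simp: rm_code_eq\<close>)

lemma rm_distance_pos: "rm_distance P d \<ge> 1"
  by (metis rm_distance_attained hamming_weight_pos)

lemma rm_distance_one_iff:
  "rm_distance P d = 1 \<longleftrightarrow> (\<exists>f\<in>polys_le d. hamming_weight (codeword P f) = 1)"
proof
  assume "rm_distance P d = 1"
  then show "\<exists>f\<in>polys_le d. hamming_weight (codeword P f) = 1"
    by (metis rm_distance_attained)
next
  assume "\<exists>f\<in>polys_le d. hamming_weight (codeword P f) = 1"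
  then obtain f where f: "f \<in> polys_le d" "hamming_weight (codeword P f) = 1" by blast
  then have "codeword P f \<noteq> (\<lambda>_. 0)" by (auto simp: hamming_weight_def)
  with f have "rm_distance P d \<le> 1" by (metis rm_distance_le)
  with rm_distance_pos [of P d] show "rm_distance P d = 1" by simp
qed

lemma rm_distance_one_mono: "rm_distance P d = 1 \<Longrightarrow> d \<le> e \<Longrightarrow> rm_distance P e = 1"
  unfolding rm_distance_one_iff using polys_le_mono by blast

lemma rm_distance_zero:
  fixes P :: "'m::finite \<Rightarrow> 's::finite \<Rightarrow> 'k::comm_ring_1"
  shows "rm_distance P 0 = card (UNIV :: 'm set)"
proof -
  obtain f where f: "f \<in> polys_le 0" "codeword P f \<noteq> (\<lambda>_. 0)"
    "hamming_weight (codeword P f) = rm_distance P 0"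
    by (rule rm_distance_attained)
  define c where "c = Poly_Mapping.lookup f 0"
  have "codeword P f = (\<lambda>_. c)"
    unfolding codeword_def c_def by (subst polys_le_zero_const [OF f(1)]) simp
  with f(2,3) show ?thesis by (auto simp: hamming_weight_def fun_eq_iff)
qed

text \<open>
  A codeword of minimum weight at least 2 loses one point of its support, but not all of it, when its
  polynomial is multiplied by a linear polynomial separating two points of the support.
\<close>

lemma rm_distance_decreasing:
  fixes P :: "'m::finite \<Rightarrow> 's::finite \<Rightarrow> 'k::field"
  assumes "inj P" and "rm_distance P d \<noteq> 1"
  shows "rm_distance P (Suc d) < rm_distance P d"
proof -
  obtain f where f: "f \<in> polys_le d" "hamming_weight (codeword P f) = rm_distance P d"
    by (rule rm_distance_attained)
  let ?S = "{j. codeword P f j \<noteq> 0}"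
  have "2 \<le> card ?S"
    using f(2) assms(2) rm_distance_pos [of P d] by (simp add: hamming_weight_def)
  then obtain a b where ab: "a \<in> ?S" "b \<in> ?S" "a \<noteq> b"
    by (metis card_le_Suc0_iff_eq finite not_less_eq_eq numeral_2_eq_2)
  with \<open>inj P\<close> obtain i where i: "P a i \<noteq> P b i"
    by (metis ext injD)
  \<comment> \<open>The linear factor kills the coordinate \<open>a\<close> of the codeword and leaves \<open>b\<close> in its support.\<close>
  let ?g = "linear_poly i (P a i) * f"
  have eval: "codeword P ?g j = (P j i - P a i) * codeword P f j" for j
    by (simp add: codeword_def)
  have "?g \<in> polys_le (Suc d)"
    using mult_in_polys_le [OF linear_poly_in_polys_le f(1)] by simp
  moreover have "codeword P ?g b \<noteq> 0"
    using ab i by (simp add: eval)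
  then have "codeword P ?g \<noteq> (\<lambda>_. 0)" by metis
  ultimately have "rm_distance P (Suc d) \<le> hamming_weight (codeword P ?g)"
    by (rule rm_distance_le)
  also have "\<dots> < card ?S"
    unfolding hamming_weight_def
    by (rule psubset_card_mono) (use ab in \<open>auto simp: eval\<close>)
  finally show ?thesis using f(2) by (simp add: hamming_weight_def)
qed


section \<open>Interpolation\<close>

text \<open>
  A product of linear polynomials, one for each other point and chosen in a coordinate in which that
  point differs from \<open>P a\<close>, vanishes at all other points but not at \<open>P a\<close>; rescaling makes its value
  at \<open>P a\<close> equal to 1.
\<close>

lemma separating_poly:
  fixes P :: "'m::finite \<Rightarrow> 's::finite \<Rightarrow> 'k::field"
  assumes "inj P"
  obtains f where "codeword P f = (\<lambda>j. if j = a then 1 else 0)"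
proof -
  have "\<exists>f. mpoly_eval f (P a) \<noteq> 0 \<and> (\<forall>b\<in>B. mpoly_eval f (P b) = 0)"
    if "finite B" "a \<notin> B" for B
    using that
  proof (induction B)
    case empty
    show ?case by (rule exI [of _ 1]) simp
  next
    case (insert b B)
    then obtain f where f: "mpoly_eval f (P a) \<noteq> 0" "\<forall>b\<in>B. mpoly_eval f (P b) = 0"
      by blast
    from insert.prems \<open>inj P\<close> obtain i where "P a i \<noteq> P b i"
      by (metis ext injD insertI1)
    with f show ?case
      by (intro exI [of _ "linear_poly i (P b i) * f"]) auto
  qed
  from this [of "- {a}"] obtain f
    where "mpoly_eval f (P a) \<noteq> 0" "\<forall>b\<in>- {a}. mpoly_eval f (P b) = 0"
    by auto
  then have "codeword P (Poly_Mapping.single 0 (1 / mpoly_eval f (P a)) * f)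
      = (\<lambda>j. if j = a then 1 else 0)"
    by (auto simp: codeword_def fun_eq_iff)
  then show ?thesis by (rule that)
qed

lemma surj_codeword:
  fixes P :: "'m::finite \<Rightarrow> 's::finite \<Rightarrow> 'k::field"
  assumes "inj P"
  shows "surj (codeword P)"
proof -
  have "\<forall>a. \<exists>f. codeword P f = (\<lambda>j. if j = a then 1 else 0)"
    using separating_poly [OF assms] by metis
  then obtain e where e: "\<And>a. codeword P (e a) = (\<lambda>j. if j = a then 1 else 0)"
    by metis
  have "codeword P (\<Sum>a\<in>UNIV. Poly_Mapping.single 0 (c a) * e a) = c" for c
  proof
    fix j
    have "codeword P (\<Sum>a\<in>UNIV. Poly_Mapping.single 0 (c a) * e a) j
        = (\<Sum>a\<in>UNIV. c a * codeword P (e a) j)"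
      by (simp add: codeword_def mpoly_eval_sum)
    then show "codeword P (\<Sum>a\<in>UNIV. Poly_Mapping.single 0 (c a) * e a) j = c j"
      by (simp add: e if_distrib cong: if_cong)
  qed
  then show ?thesis by (rule surjI)
qed

text \<open>
  Over a finite field there are only finitely many words, so the degrees of polynomials that realise
  them are bounded.
\<close>

lemma rm_code_eventually_UNIV:
  fixes P :: "'m::finite \<Rightarrow> 's::finite \<Rightarrow> 'k::{field,finite}"
  assumes "inj P"
  obtains n where "\<And>d. n \<le> d \<Longrightarrow> rm_code P d = UNIV"
proof -
  define f where "f c = (SOME f. codeword P f = c)" for c
  have f: "codeword P (f c) = c" for c
    unfolding f_def by (rule someI_ex) (metis surj_codeword [OF assms] surjD)
  define n where "n = Max (range (total_degree \<circ> f))"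
  have "f c \<in> polys_le d" if "n \<le> d" for c d
  proof -
    have "total_degree (f c) \<le> n" unfolding n_def by (rule Max_ge) auto
    with that show ?thesis by (simp add: polys_le_def)
  qed
  with f have "rm_code P d = UNIV" if "n \<le> d" for d
    unfolding rm_code_eq using that by (metis UNIV_eq_I image_eqI)
  then show ?thesis by (rule that)
qed

lemma rm_distance_UNIV:
  assumes "rm_code P d = UNIV"
  shows "rm_distance P d = 1"
proof -
  \<comment> \<open>Here \<open>undefined\<close> is just some coordinate.\<close>
  have "(\<lambda>j. if j = undefined then 1 else 0) \<in> codeword P ` polys_le d"
    using assms by (simp add: rm_code_eq)
  then obtain f
    where "f \<in> polys_le d" "codeword P f = (\<lambda>j. if j = undefined then 1 else 0)"
    by (metis imageE)
  moreover from this have "hamming_weight (codeword P f) = 1"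
    unfolding hamming_weight_one_iff by auto
  ultimately show ?thesis
    unfolding rm_distance_one_iff by blast
qed


section \<open>The regularity index of the minimum distance\<close>

text \<open>
  The least degree of distance 1 meets the conditions that describe the regularity index.  No other
  number does: a smaller one contradicts minimality, and a larger one would require a further
  strict decrease from distance 1, whereas distances are positive.
\<close>

lemma reg_distance_eq_Least:
  fixes P :: "'m::finite \<Rightarrow> 's::finite \<Rightarrow> 'k::{field,finite}"
  assumes "inj P"
  shows "reg_distance P = (LEAST d. rm_distance P d = 1)"
proof -
  let ?n = "LEAST d. rm_distance P d = 1"
  obtain N where "\<And>d. N \<le> d \<Longrightarrow> rm_code P d = UNIV"
    using rm_code_eventually_UNIV [OF assms] by metis
  then have "rm_distance P N = 1" by (intro rm_distance_UNIV) simp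
  then have n: "rm_distance P ?n = 1" by (rule LeastI)
  have below: "rm_distance P i \<noteq> 1" if "i < ?n" for i
    using not_less_Least [OF that] .
  show "reg_distance P = ?n"
    unfolding reg_distance_def
  proof (rule the_equality)
    show "card (range P) = rm_distance P 0 \<and>
        (\<forall>i<?n. rm_distance P i > rm_distance P (Suc i)) \<and> (\<forall>d\<ge>?n. rm_distance P d = 1)"
    proof (intro conjI allI impI)
      show "card (range P) = rm_distance P 0"
        using assms by (simp add: rm_distance_zero card_image)
      show "rm_distance P i > rm_distance P (Suc i)" if "i < ?n" for i
        using assms below [OF that] by (rule rm_distance_decreasing)
      show "rm_distance P d = 1" if "?n \<le> d" for d
        using n that by (rule rm_distance_one_mono)
    qed
  next
    fix n'
    assume n': "card (range P) = rm_distance P 0 \<and>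
        (\<forall>i<n'. rm_distance P i > rm_distance P (Suc i)) \<and> (\<forall>d\<ge>n'. rm_distance P d = 1)"
    show "n' = ?n"
    proof (rule antisym)
      show "?n \<le> n'" using n' by (intro Least_le) auto
      show "n' \<le> ?n"
      proof (rule ccontr)
        assume "\<not> n' \<le> ?n"
        with n' n have "rm_distance P (Suc ?n) < 1" by (metis not_le)
        with rm_distance_pos [of P "Suc ?n"] show False by simp
      qed
    qed
  qed
qed


section \<open>Colon ideals and the v-number\<close>

lemma ideal_vanishing_ideal:
  "ideal (vanishing_ideal X) (class_ring :: ('s::finite, 'k::comm_ring_1) mpoly ring)"
proof (rule idealI)
  show "ring (class_ring :: ('s, 'k) mpoly ring)" by (rule class_ring.ring_axioms)
  show "subgroup (vanishing_ideal X) (add_monoid (class_ring :: ('s, 'k) mpoly ring))"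
  proof (rule subgroup.intro)
    fix f :: "('s, 'k) mpoly" assume "f \<in> vanishing_ideal X"
    moreover have "inv\<^bsub>add_monoid class_ring\<^esub> f = - f"
      unfolding a_inv_def [symmetric] by (simp add: class_ring_simps)
    ultimately show "inv\<^bsub>add_monoid class_ring\<^esub> f \<in> vanishing_ideal X"
      by (simp only:) (simp add: vanishing_ideal_def)
  qed (auto simp: vanishing_ideal_def)
qed (auto simp: vanishing_ideal_def)

text \<open>
  The colon ideal by \<open>f\<close> is by construction the annihilator of the class of \<open>f\<close> in the quotient, so
  only primality decides whether it is an associated prime.
\<close>

lemma colon_ideal_in_assoc_primes_iff:
  fixes I :: "'a::comm_ring_1 set"
  assumes "ideal I class_ring"
  shows "colon_ideal I f \<in> assoc_primes class_ring I \<longleftrightarrow> primeideal (colon_ideal I f) class_ring"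
proof -
  interpret ideal I "class_ring :: 'a ring" by (rule assms)
  let ?R = "class_ring :: 'a ring"
  have "(I +>\<^bsub>?R\<^esub> r) \<otimes>\<^bsub>?R Quot I\<^esub> (I +>\<^bsub>?R\<^esub> f) = \<zero>\<^bsub>?R Quot I\<^esub> \<longleftrightarrow> r * f \<in> I" for r
  proof -
    have "(I +>\<^bsub>?R\<^esub> r) \<otimes>\<^bsub>?R Quot I\<^esub> (I +>\<^bsub>?R\<^esub> f) = I +>\<^bsub>?R\<^esub> (r * f)"
      using rcoset_mult_add [of r f] by (simp add: FactRing_def)
    moreover have "I +>\<^bsub>?R\<^esub> (r * f) = I \<longleftrightarrow> r * f \<in> I"
      using a_rcos_self [of "r * f"] a_rcos_const [of "r * f"] by auto
    ultimately show ?thesis by (simp add: FactRing_def)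
  qed
  moreover have "I +>\<^bsub>?R\<^esub> f \<in> carrier (?R Quot I)"
    by (auto simp: FactRing_def A_RCOSETS_def' a_r_coset_def')
  ultimately show ?thesis
    unfolding assoc_primes_def colon_ideal_def by auto
qed

text \<open>
  A product \<open>g f\<close> vanishes on \<open>X\<close> iff \<open>g\<close> vanishes wherever \<open>f\<close> does not, as the values lie in a field.
\<close>

lemma colon_vanishing_ideal:
  fixes P :: "'m \<Rightarrow> 's::finite \<Rightarrow> 'k::field"
  shows "colon_ideal (vanishing_ideal (range P)) f = vanishing_ideal (P ` {j. codeword P f j \<noteq> 0})"
  by (auto simp: colon_ideal_def vanishing_ideal_def codeword_def)

lemma primeideal_vanishing_ideal_point:
  "primeideal (vanishing_ideal {x}) (class_ring :: ('s::finite, 'k::field) mpoly ring)"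
proof (rule primeidealI)
  show "ideal (vanishing_ideal {x}) (class_ring :: ('s, 'k) mpoly ring)"
    by (rule ideal_vanishing_ideal)
  show "cring (class_ring :: ('s, 'k) mpoly ring)" by (rule class_cring.cring_axioms)
  have "1 \<notin> vanishing_ideal {x}" by (simp add: vanishing_ideal_def)
  then show "carrier (class_ring :: ('s, 'k) mpoly ring) \<noteq> vanishing_ideal {x}" by auto
qed (auto simp: vanishing_ideal_def)

text \<open>
  If the set contained two points, the polynomial \<open>e\<close> that is 1 at one of them and 0 at all other
  points would give the product \<open>e (1 - e)\<close> in the ideal with neither factor in it.  The empty set
  yields the unit ideal, which is not prime.
\<close>

lemma primeideal_vanishing_ideal_iff:
  fixes P :: "'m::finite \<Rightarrow> 's::finite \<Rightarrow> 'k::field"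
  assumes "inj P"
  shows "primeideal (vanishing_ideal (P ` S)) class_ring \<longleftrightarrow> (\<exists>a. S = {a})"
proof
  assume "\<exists>a. S = {a}"
  then show "primeideal (vanishing_ideal (P ` S)) class_ring"
    by (auto simp: primeideal_vanishing_ideal_point)
next
  assume "primeideal (vanishing_ideal (P ` S)) class_ring"
  then interpret primeideal "vanishing_ideal (P ` S)" "class_ring :: ('s, 'k) mpoly ring" .
  have "S \<noteq> {}"
  proof
    assume "S = {}"
    then show False using I_notcarr by (auto simp: vanishing_ideal_def)
  qed
  then obtain a where a: "a \<in> S" by blast
  have "b = a" if b: "b \<in> S" for b
  proof (rule ccontr)
    assume "b \<noteq> a"
    obtain e where e: "codeword P e = (\<lambda>j. if j = a then 1 else 0)"
      by (rule separating_poly [OF assms])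
    have e': "mpoly_eval e (P j) = (if j = a then 1 else 0)" for j
      using e by (simp add: codeword_def fun_eq_iff)
    have "e * (1 - e) \<in> vanishing_ideal (P ` S)"
      by (auto simp: vanishing_ideal_def e')
    then have "e \<in> vanishing_ideal (P ` S) \<or> 1 - e \<in> vanishing_ideal (P ` S)"
      using I_prime [of e "1 - e"] by simp
    moreover have "e \<notin> vanishing_ideal (P ` S)"
      using a by (auto simp: vanishing_ideal_def e')
    moreover have "1 - e \<notin> vanishing_ideal (P ` S)"
      using b \<open>b \<noteq> a\<close> by (auto simp: vanishing_ideal_def e')
    ultimately show False by blast
  qed
  with a show "\<exists>a. S = {a}" by blast
qed

lemma v_number_vanishing_ideal:
  fixes P :: "'m::finite \<Rightarrow> 's::finite \<Rightarrow> 'k::field"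
  assumes "inj P"
  shows "v_number (vanishing_ideal (range P)) =
    (LEAST d. \<exists>f. total_degree f = d \<and> hamming_weight (codeword P f) = 1)"
proof -
  let ?I = "vanishing_ideal (range P)"
  have "colon_ideal ?I f \<in> assoc_primes class_ring ?I \<longleftrightarrow> hamming_weight (codeword P f) = 1" for f
    unfolding colon_ideal_in_assoc_primes_iff [OF ideal_vanishing_ideal]
    unfolding colon_vanishing_ideal primeideal_vanishing_ideal_iff [OF assms]
      hamming_weight_one_iff ..
  moreover have "f \<noteq> 0" if "hamming_weight (codeword P f) = 1" for f
    using that by (auto simp: hamming_weight_def codeword_def)
  ultimately have "(\<exists>f p. f \<noteq> 0 \<and> total_degree f = d \<and> p \<in> assoc_primes class_ring ?I
      \<and> colon_ideal ?I f = p) \<longleftrightarrow> (\<exists>f. total_degree f = d \<and> hamming_weight (codeword P f) = 1)"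
    for d by metis
  then show ?thesis by (simp add: v_number_def)
qed

text \<open>
  The v-number asks for the exact degree of a polynomial with a codeword of weight 1, the code of
  degree \<open>d\<close> only for degree at most \<open>d\<close>; the least value is the same.
\<close>

lemma v_number_eq_Least:
  fixes P :: "'m::finite \<Rightarrow> 's::finite \<Rightarrow> 'k::field"
  assumes "inj P"
  shows "v_number (vanishing_ideal (range P)) = (LEAST d. rm_distance P d = 1)"
proof -
  let ?A = "\<lambda>d. \<exists>f. total_degree f = d \<and> hamming_weight (codeword P f) = 1"
  obtain f where "codeword P f = (\<lambda>j. if j = undefined then 1 else 0)"
    by (rule separating_poly [OF assms])
  then have "hamming_weight (codeword P f) = 1"
    unfolding hamming_weight_one_iff by auto
  then have ex: "?A (total_degree f)" by blast
  have B: "rm_distance P d = 1 \<longleftrightarrow> (\<exists>e\<le>d. ?A e)" for d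
    unfolding rm_distance_one_iff polys_le_def by blast
  have "(LEAST d. rm_distance P d = 1) = (LEAST d. ?A d)"
  proof (rule Least_equality)
    show "rm_distance P (LEAST d. ?A d) = 1"
      unfolding B using LeastI [of ?A, OF ex] by blast
    show "(LEAST d. ?A d) \<le> d" if "rm_distance P d = 1" for d
    proof -
      from that obtain e where "e \<le> d" "?A e" unfolding B by blast
      then show ?thesis using Least_le [of ?A e] by simp
    qed
  qed
  then show ?thesis by (simp add: v_number_vanishing_ideal [OF assms])
qed


section \<open>The affine Hilbert function\<close>

text \<open>
  Every vector has unique coordinates with respect to a finite basis.
\<close>

lemma (in vectorspace) card_carrier_eq_power_dim:
  assumes "finite (carrier V)"
  shows "card (carrier V) = card (carrier K) ^ dim"
proof -
  have "span (carrier V) = carrier V"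
    using span_mem [of "carrier V"] span_is_subset2 [of "carrier V"] by blast
  with assms have "fin_dim" unfolding fin_dim_def by blast
  then obtain A where A: "finite A" "basis A" using finite_basis_exists by blast
  then have AV: "A \<subseteq> carrier V" by (simp add: basis_def)
  have crit: "\<exists>!a. a \<in> A \<rightarrow>\<^sub>E carrier K \<and> lincomb a A = v" if "v \<in> carrier V" for v
    using basis_criterion [OF A(1) AV] A(2) that by blast
  have "bij_betw (\<lambda>a. lincomb a A) (A \<rightarrow>\<^sub>E carrier K) (carrier V)"
  proof (rule bij_betwI')
    fix a b assume ab: "a \<in> A \<rightarrow>\<^sub>E carrier K" "b \<in> A \<rightarrow>\<^sub>E carrier K"
    then have "lincomb b A \<in> carrier V" by (intro lincomb_closed AV) auto
    with crit ab show "lincomb a A = lincomb b A \<longleftrightarrow> a = b" by metis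
  next
    fix a assume "a \<in> A \<rightarrow>\<^sub>E carrier K"
    then show "lincomb a A \<in> carrier V" by (intro lincomb_closed AV) auto
  next
    fix v assume "v \<in> carrier V"
    then show "\<exists>a\<in>A \<rightarrow>\<^sub>E carrier K. v = lincomb a A" using crit by metis
  qed
  then have "card (carrier V) = card (A \<rightarrow>\<^sub>E carrier K)" by (simp add: bij_betw_same_card)
  also have "\<dots> = card (carrier K) ^ card A" using A(1) by (simp add: card_PiE)
  also have "card A = dim" using dim_basis A by simp
  finally show ?thesis .
qed

text \<open>
  Scalars act on the polynomial ring by multiplication with constant polynomials.
\<close>

definition poly_subspace :: "('s, 'k::comm_ring_1) mpoly set \<Rightarrow> bool" where
  "poly_subspace W \<longleftrightarrow> 0 \<in> W \<and> (\<forall>f\<in>W. \<forall>g\<in>W. f + g \<in> W) \<and>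
     (\<forall>c. \<forall>f\<in>W. Poly_Mapping.single 0 c * f \<in> W)"

lemma poly_subspace_uminus:
  assumes "poly_subspace W" and "f \<in> W"
  shows "- f \<in> W"
proof -
  have "Poly_Mapping.single 0 (- 1) * f \<in> W" using assms by (simp add: poly_subspace_def)
  then show ?thesis by (simp add: single_uminus)
qed

lemma coset_eq_iff: "f \<in> (+) v ` W \<longleftrightarrow> f - v \<in> (W :: ('s, 'k::comm_ring_1) mpoly set)"
  by (auto simp: image_iff algebra_simps intro: bexI [of _ "f - v"])

lemma coset_add:
  assumes "poly_subspace W"
  shows "{a + b |a b. a \<in> (+) u ` W \<and> b \<in> (+) v ` W} = (+) (u + v) ` W" (is "?L = ?R")
proof
  show "?L \<subseteq> ?R"
  proof
    fix f assume "f \<in> ?L"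
    then obtain w w' where "w \<in> W" "w' \<in> W" "f = (u + v) + (w + w')"
      by (auto simp: algebra_simps)
    then show "f \<in> ?R" using assms by (auto simp: poly_subspace_def)
  qed
  show "?R \<subseteq> ?L"
  proof
    fix f assume "f \<in> ?R"
    then obtain w where "w \<in> W" "f = (u + w) + (v + 0)" by (auto simp: algebra_simps)
    moreover have "0 \<in> W" using assms by (simp add: poly_subspace_def)
    ultimately show "f \<in> ?L" by blast
  qed
qed

lemma coset_smult:
  assumes "poly_subspace W"
  shows "(\<Union>a\<in>(+) v ` W. (+) (Poly_Mapping.single 0 c * a) ` W)
    = (+) (Poly_Mapping.single 0 c * v) ` W" (is "?L = ?R")
proof
  show "?L \<subseteq> ?R"
  proof
    fix f assume "f \<in> ?L"
    then obtain w w' where "w \<in> W" "w' \<in> W"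
      "f = Poly_Mapping.single 0 c * v + (Poly_Mapping.single 0 c * w + w')"
      by (auto simp: algebra_simps)
    then show "f \<in> ?R" using assms by (auto simp: poly_subspace_def)
  qed
  have "v \<in> (+) v ` W" using assms by (auto simp: poly_subspace_def image_iff)
  then show "?R \<subseteq> ?L" by blast
qed

text \<open>
  The operations on cosets are those induced by representatives (\<open>coset_add\<close>, \<open>coset_smult\<close>), so the
  vector space laws descend from the polynomial ring.
\<close>

lemma vectorspace_quotient_space:
  fixes V W :: "('s::finite, 'k::field) mpoly set"
  assumes V: "poly_subspace V" and W: "poly_subspace W"
  shows "vectorspace (class_ring :: 'k ring) (quotient_space V W)"
proof -
  let ?Q = "quotient_space V W"
  \<comment> \<open>Cosets stay opaque, so that the laws are checked on representatives only.\<close>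
  define cl where "cl v = (+) v ` W" for v
  have carrier: "carrier ?Q = cl ` V"
    by (auto simp: quotient_space_def cl_def)
  have add: "cl u \<oplus>\<^bsub>?Q\<^esub> cl v = cl (u + v)" for u v
    using coset_add [OF W] by (simp add: quotient_space_def cl_def)
  have smult: "c \<odot>\<^bsub>?Q\<^esub> cl v = cl (Poly_Mapping.single 0 c * v)" for c v
    using coset_smult [OF W] by (simp add: quotient_space_def cl_def)
  have zero: "\<zero>\<^bsub>?Q\<^esub> = cl 0"
    by (simp add: quotient_space_def cl_def)
  have VD: "0 \<in> V" "\<And>u v. u \<in> V \<Longrightarrow> v \<in> V \<Longrightarrow> u + v \<in> V"
    "\<And>c v. v \<in> V \<Longrightarrow> Poly_Mapping.single 0 c * v \<in> V" "\<And>v. v \<in> V \<Longrightarrow> - v \<in> V"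
    using V poly_subspace_uminus [OF V] by (auto simp: poly_subspace_def)
  have neg: "\<forall>v\<in>carrier ?Q. \<exists>neg_v\<in>carrier ?Q. v \<oplus>\<^bsub>?Q\<^esub> neg_v = \<zero>\<^bsub>?Q\<^esub>"
  proof
    fix v assume "v \<in> carrier ?Q"
    then obtain u where "u \<in> V" "v = cl u" by (auto simp: carrier)
    then show "\<exists>neg_v\<in>carrier ?Q. v \<oplus>\<^bsub>?Q\<^esub> neg_v = \<zero>\<^bsub>?Q\<^esub>"
      using VD(4) by (intro bexI [of _ "cl (- u)"]) (auto simp: add zero carrier)
  qed
  have single_mult: "Poly_Mapping.single 0 (a * b) * v
      = Poly_Mapping.single 0 a * (Poly_Mapping.single 0 b * v)" for a b :: 'k and v :: "('s, 'k) mpoly"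
    by (simp add: mult_single flip: mult.assoc)
  show ?thesis
    by (rule vs_criteria [OF class_field _ _ neg])
      (auto simp: carrier add smult zero VD single_mult single_add distrib_left distrib_right
        add.commute add.left_commute)
qed

lemma poly_subspace_polys_le: "poly_subspace (polys_le d)"
  by (simp add: poly_subspace_def zero_in_polys_le add_in_polys_le const_mult_in_polys_le)

lemma poly_subspace_vanishing_le: "poly_subspace (vanishing_ideal X \<inter> polys_le d)"
  using poly_subspace_polys_le [of d] by (auto simp: poly_subspace_def vanishing_ideal_def)

text \<open>
  Two polynomials of degree at most \<open>d\<close> are congruent modulo the vanishing ideal iff they have the same
  codeword, so the cosets are the nonempty fibres of the evaluation map.
\<close>

lemma card_quotient_space:
  fixes P :: "'m::finite \<Rightarrow> 's::finite \<Rightarrow> 'k::comm_ring_1"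
  shows "card (carrier (quotient_space (polys_le d) (vanishing_ideal (range P) \<inter> polys_le d)))
    = card (rm_code P d)"
proof -
  let ?V = "polys_le d :: ('s, 'k) mpoly set"
  let ?W = "vanishing_ideal (range P) \<inter> ?V"
  let ?fibre = "\<lambda>c. {f \<in> ?V. codeword P f = c}"
  note V = poly_subspace_polys_le [of d]
  have fibre: "(+) v ` ?W = ?fibre (codeword P v)" if v: "v \<in> ?V" for v
  proof -
    have "f - v \<in> ?V \<longleftrightarrow> f \<in> ?V" for f
    proof
      assume "f - v \<in> ?V"
      from add_in_polys_le [OF this v] show "f \<in> ?V" by simp
    next
      assume "f \<in> ?V"
      from add_in_polys_le [OF this poly_subspace_uminus [OF V v]] show "f - v \<in> ?V" by simp
    qed
    moreover have "f - v \<in> vanishing_ideal (range P) \<longleftrightarrow> codeword P f = codeword P v" for f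
      by (auto simp: vanishing_ideal_def codeword_def fun_eq_iff)
    ultimately show ?thesis
      by (simp only: set_eq_iff coset_eq_iff Int_iff mem_Collect_eq) blast
  qed
  have "carrier (quotient_space ?V ?W) = (\<lambda>v. (+) v ` ?W) ` ?V"
    by (auto simp: quotient_space_def)
  also have "\<dots> = ?fibre ` rm_code P d"
    by (simp add: fibre rm_code_eq image_image)
  also have "card \<dots> = card (rm_code P d)"
    by (rule card_image) (auto simp: inj_on_def rm_code_eq)
  finally show ?thesis .
qed

text \<open>
  With \<open>q\<close> the size of the field, the code has \<open>q\<^sup>h\<close> words, \<open>h\<close> being the value of the Hilbert
  function, whereas the whole space has \<open>q\<^sup>m\<close>; and \<open>q > 1\<close> allows exponents to be compared.
\<close>

lemma affine_hilbert_eq_card_iff: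
  fixes P :: "'m::finite \<Rightarrow> 's::finite \<Rightarrow> 'k::{field,finite}"
  assumes "inj P"
  shows "affine_hilbert (vanishing_ideal (range P)) d = card (range P) \<longleftrightarrow> rm_code P d = UNIV"
proof -
  let ?q = "card (UNIV :: 'k set)" and ?h = "affine_hilbert (vanishing_ideal (range P)) d"
  let ?V = "polys_le d :: ('s, 'k) mpoly set"
  let ?Q = "quotient_space ?V (vanishing_ideal (range P) \<inter> ?V)"
  interpret Q: vectorspace "class_ring :: 'k ring" ?Q
    by (intro vectorspace_quotient_space poly_subspace_polys_le poly_subspace_vanishing_le)
  have card: "card (carrier ?Q) = card (rm_code P d)"
    by (rule card_quotient_space)
  have "rm_code P d \<noteq> {}" unfolding rm_code_eq using zero_in_polys_le by blast
  then have "finite (carrier ?Q)"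
    using card by (metis card.infinite card_eq_0_iff finite)
  then have "card (rm_code P d) = ?q ^ ?h"
    using Q.card_carrier_eq_power_dim card by (simp add: affine_hilbert_def)
  moreover have "rm_code P d = UNIV \<longleftrightarrow> card (rm_code P d) = card (UNIV :: ('m \<Rightarrow> 'k) set)"
    by (metis card_subset_eq finite subset_UNIV)
  moreover have "card (UNIV :: ('m \<Rightarrow> 'k) set) = ?q ^ card (range P)"
    using card_PiE [of "UNIV :: 'm set" "\<lambda>_. UNIV :: 'k set"] assms
    by (simp add: card_image PiE_UNIV_domain)
  moreover have "card {0, 1 :: 'k} \<le> ?q" by (rule card_mono) auto
  then have "1 < ?q" by simp
  ultimately show ?thesis by simp
qed

text \<open>
  At the regularity index of the Hilbert function the code is the whole space, and its distance is 1.
  That this index is attained at all is due to \<open>rm_code_eventually_UNIV\<close>: otherwise \<open>LEAST\<close> would be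
  an arbitrary number.
\<close>

lemma reg_distance_le_reg_hilbert:
  fixes P :: "'m::finite \<Rightarrow> 's::finite \<Rightarrow> 'k::{field,finite}"
  assumes "inj P"
  shows "reg_distance P \<le> reg_hilbert (range P)"
proof -
  let ?full = "\<lambda>l. \<forall>d\<ge>l. rm_code P d = UNIV"
  have "reg_hilbert (range P) = (LEAST l. ?full l)"
    by (simp only: reg_hilbert_def affine_hilbert_eq_card_iff [OF assms])
  moreover obtain n where "?full n"
    using rm_code_eventually_UNIV [OF assms] by metis
  then have "?full (LEAST l. ?full l)" by (rule LeastI)
  ultimately have "?full (reg_hilbert (range P))" by (simp only:)
  then have "rm_code P (reg_hilbert (range P)) = UNIV" by blast
  then have "rm_distance P (reg_hilbert (range P)) = 1" by (rule rm_distance_UNIV)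
  then show ?thesis unfolding reg_distance_eq_Least [OF assms] by (rule Least_le)
qed

theorem proposition6p2:
  fixes P :: "'m::finite \<Rightarrow> 's::finite \<Rightarrow> 'k::{field,finite}"
    and X :: "('s \<Rightarrow> 'k) set"
    and I :: "('s, 'k) mpoly set"
  assumes "inj P" and "X = range P" and "card X \<ge> 2"
    and "I = vanishing_ideal X"
  shows "v_number I = reg_distance P \<and> reg_distance P \<le> reg_hilbert X"
  unfolding assms(2,4) v_number_eq_Least [OF assms(1)]
  using reg_distance_eq_Least [OF assms(1)] reg_distance_le_reg_hilbert [OF assms(1)] by simp

end
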